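(* Let $m,n\in\mathbb{N}$ (positive integers) and $0<p,q\le\infty$. Let $B_{p,q}^{m,n}(\mathbb{C})=\{z\in\mathbb{C}^{n\times m}:\|z\|_{p,q}\le 1\}$ and, for $0<r,s\le\infty$, $B_{r,s}^{m,n}(\mathbb{R})=\{x\in\mathbb{R}^{n\times m}:\|x\|_{r,s}\le 1\}$. Then $$\operatorname{vol}(B_{p,q}^{m,n}(\mathbb{C}))=\left(\frac{\pi}{2}\right)^{mn}\operatorname{vol}\left(B_{\frac p2,\frac q2}^{m,n}(\mathbb{R})\right)=\pi^{mn}\,\frac{\Gamma\left(\frac2p+1\right)^{mn}}{\Gamma\left(\frac{2nm}{q}+1\right)}\cdot\frac{\Gamma\left(\frac{2m}{q}+1\right)^n}{\Gamma\left(\frac{2m}{p}+1\right)^n}.$$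
   Context: For a real or complex array $z=(z_{j,k})_{1\le j\le n,\,1\le k\le m}$ and $0<p,q<\infty$, $$\|z\|_{p,q}=\Biggl(\sum_{j=1}^n\Bigl(\sum_{k=1}^m |z_{j,k}|^p\Bigr)^{q/p}\Biggr)^{1/q},$$ with the usual modifications if $p$ or $q$ is infinite: if $p=\infty$ the inner expression $\bigl(\sum_{k}|z_{j,k}|^p\bigr)^{1/p}$ is replaced by $\max_{1\le k\le m}|z_{j,k}|$, and if $q=\infty$ the outer $\ell_q$-sum over $j$ is replaced by $\max_{1\le j\le n}$. The volume of a subset of $\mathbb{R}^{n\times m}$ is its Lebesgue measure in $\mathbb{R}^{nm}$. The volume of a subset of $\mathbb{C}^{n\times m}$ is its Lebesgue measure in $\mathbb{R}^{2nm}$, where $\mathbb{C}$ is identified with $\mathbb{R}^2$ via $z_{j,k}=u_{j,k}+iv_{j,k}\mapsto(u_{j,k},v_{j,k})$. $\Gamma$ is the gamma function. Conventions: $1/\infty=0$ and $\infty/2=\infty$. *)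

theory Defs
  imports "HOL-Analysis.Analysis"
begin

text \<open>
  Since \<^term>\<open>0 powr a = 0\<close> for every real \<open>a\<close>, zero entries contribute \<open>0\<close> for every finite
  exponent. Only positive exponents are meaningful.
\<close>

definition lp_norm :: "ereal \<Rightarrow> ('i::finite \<Rightarrow> 'a::real_normed_vector) \<Rightarrow> real" where
  "lp_norm p a =
     (if p = \<infinity> then Max (range (\<lambda>i. norm (a i)))
      else (\<Sum>i\<in>UNIV. norm (a i) powr real_of_ereal p) powr (1 / real_of_ereal p))"

text \<open>
  An \<open>n \<times> m\<close> array has rows indexed by \<open>'n\<close> and columns by \<open>'m\<close>. For finite \<open>p\<close> and \<open>q\<close> the
  summand of the outer sum is \<open>(S powr (1/p)) powr q = S powr (q/p)\<close>.
\<close>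

definition mixed_norm :: "ereal \<Rightarrow> ereal \<Rightarrow> 'a::real_normed_vector ^ 'm ^ 'n \<Rightarrow> real" where
  "mixed_norm p q z = lp_norm q (\<lambda>j. lp_norm p (\<lambda>k. z $ j $ k))"

definition mixed_ball :: "ereal \<Rightarrow> ereal \<Rightarrow> ('a::real_normed_vector ^ 'm ^ 'n) set" where
  "mixed_ball p q = {z. mixed_norm p q z \<le> 1}"

end

theory Submission imports Defs begin

text \<open>
  Let \<open>f\<close> be a nonnegative positively homogeneous function on a \<open>D\<close>-dimensional space whose unit ball
  has volume \<open>C\<close>. Writing \<open>exp (- s)\<close> as the integral of \<open>exp (- t)\<close> over \<open>t \<ge> s\<close> and using
  \<open>vol {f \<le> t} = C t^D\<close>, the integral of \<open>exp (- f^q)\<close> is \<open>C \<Gamma>(D/q + 1)\<close>. On the \<open>k\<close>-fold product,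
  \<open>(\<Sum>\<^sub>i f(v\<^sub>i)^q)^(1/q)\<close> is again homogeneous, and the integral of \<open>exp (- \<Sum>\<^sub>i f(v\<^sub>i)^q)\<close> factorises,
  so its unit ball has volume \<open>C^k \<Gamma>(D/q + 1)^k / \<Gamma>(kD/q + 1)\<close>. Applying this once to the norm on
  \<open>\<complex>\<close> or \<open>\<real>\<close> with exponent \<open>p\<close> and once more with exponent \<open>q\<close> gives the mixed-norm ball in both
  cases; only \<open>D/p\<close>, \<open>D/q\<close> and \<open>C\<close> enter, so halving \<open>p\<close> and \<open>q\<close> compensates passing from \<open>D = 2\<close>,
  \<open>C = \<pi>\<close> to \<open>D = 1\<close>, \<open>C = 2\<close>.
\<close>

text \<open>Homogeneity without a triangle inequality, since \<open>lp_norm\<close> with an exponent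
  below 1 is only a quasi-norm.\<close>

definition gauge_fn :: "('a::euclidean_space \<Rightarrow> real) \<Rightarrow> bool" where
  "gauge_fn f \<longleftrightarrow> f \<in> borel_measurable borel \<and> (\<forall>v. 0 \<le> f v) \<and>
     (\<forall>s>0. \<forall>v. f (s *\<^sub>R v) = s * f v)"

lemma gauge_fn_measurable [measurable_dest]: "gauge_fn f \<Longrightarrow> f \<in> borel_measurable borel"
  and gauge_fn_nonneg: "gauge_fn f \<Longrightarrow> 0 \<le> f v"
  and gauge_fn_scaleR: "gauge_fn f \<Longrightarrow> s > 0 \<Longrightarrow> f (s *\<^sub>R v) = s * f v"
  by (auto simp: gauge_fn_def)

lemma gauge_fn_norm: "gauge_fn (norm :: 'a::euclidean_space \<Rightarrow> real)"
  by (auto simp: gauge_fn_def)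

text \<open>The dilation by \<open>t\<close> carries the unit sublevel set onto the one at level
  \<open>t\<close> and multiplies Lebesgue measure by \<open>t ^ DIM('a)\<close>.\<close>

lemma emeasure_gauge_le:
  fixes f :: "'a::euclidean_space \<Rightarrow> real"
  assumes f: "gauge_fn f" and t: "t > 0"
  shows "emeasure lborel {v. f v \<le> t} = ennreal (t ^ DIM('a)) * emeasure lborel {v. f v \<le> 1}"
proof -
  note [measurable] = gauge_fn_measurable[OF f]
  have "emeasure lborel {v. f v \<le> t} =
      emeasure (density (distr lborel borel (\<lambda>x::'a. 0 + t *\<^sub>R x)) (\<lambda>_. \<bar>t\<bar> ^ DIM('a))) {v. f v \<le> t}"
    using t by (subst lborel_affine[of t 0]) auto
  also have "\<dots> = ennreal (t ^ DIM('a)) * emeasure (distr lborel borel (\<lambda>x::'a. t *\<^sub>R x)) {v. f v \<le> t}"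
    using t by (subst emeasure_density) (auto simp: nn_integral_cmult)
  also have "emeasure (distr lborel borel (\<lambda>x::'a. t *\<^sub>R x)) {v. f v \<le> t} =
      emeasure lborel {v. f (t *\<^sub>R v) \<le> t}"
    by (subst emeasure_distr) (auto simp: vimage_def)
  also have "{v. f (t *\<^sub>R v) \<le> t} = {v. f v \<le> 1}"
    using t by (simp add: gauge_fn_scaleR[OF f])
  finally show ?thesis .
qed

lemma nn_integral_exp_minus_atLeast:
  "(\<integral>\<^sup>+t. ennreal (exp (- t)) * indicator {a..} t \<partial>lborel) = ennreal (exp (- a))"
proof -
  have "((\<lambda>t::real. exp (- 1 * t)) has_integral exp (- 1 * a) / 1) {a..}"
    by (rule has_integral_exp_minus_to_infinity) simp
  from nn_integral_has_integral_lebesgue[OF _ this]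
  have "(\<integral>\<^sup>+t. ennreal (indicator {a..} t * exp (- t)) \<partial>lborel) = ennreal (exp (- a))"
    by simp
  then show ?thesis
    by (simp add: ennreal_mult' mult.commute flip: ennreal_indicator)
qed

lemma nn_integral_exp_gauge:
  fixes f :: "'a::euclidean_space \<Rightarrow> real"
  assumes f: "gauge_fn f" and q: "q > 0"
  shows "(\<integral>\<^sup>+v. ennreal (exp (- (f v powr q))) \<partial>lborel) =
           ennreal (Gamma (DIM('a) / q + 1)) * emeasure lborel {v. f v \<le> 1}"
proof -
  note [measurable] = gauge_fn_measurable[OF f]
  let ?V = "emeasure lborel {v. f v \<le> 1}"
  have "(\<integral>\<^sup>+v. ennreal (exp (- (f v powr q))) \<partial>lborel) =
      (\<integral>\<^sup>+v. (\<integral>\<^sup>+t. ennreal (exp (- t)) * indicator {f v powr q..} t \<partial>lborel) \<partial>lborel)"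
    by (simp add: nn_integral_exp_minus_atLeast)
  \<comment> \<open>As a conditional, the integrand is visibly jointly measurable in
    \<open>v\<close> and \<open>t\<close>, as Tonelli requires.\<close>
  also have "\<dots> = (\<integral>\<^sup>+v. (\<integral>\<^sup>+t. ennreal (exp (- t)) * (if f v powr q \<le> t then 1 else 0) \<partial>lborel) \<partial>lborel)"
    by (simp add: indicator_def of_bool_def)
  also have "\<dots> = (\<integral>\<^sup>+t. (\<integral>\<^sup>+v. ennreal (exp (- t)) * (if f v powr q \<le> t then 1 else 0) \<partial>lborel) \<partial>lborel)"
    by (rule lborel_pair.Fubini'[symmetric]) measurable
  also have "\<dots> = (\<integral>\<^sup>+t. ennreal (exp (- t)) * emeasure lborel {v. f v powr q \<le> t} \<partial>lborel)"
  proof (rule nn_integral_cong)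
    fix t
    have "(\<integral>\<^sup>+v. ennreal (exp (- t)) * (if f v powr q \<le> t then 1 else 0) \<partial>lborel) =
        (\<integral>\<^sup>+v. ennreal (exp (- t)) * indicator {v. f v powr q \<le> t} v \<partial>lborel)"
      by (simp add: indicator_def of_bool_def)
    also have "\<dots> = ennreal (exp (- t)) * emeasure lborel {v. f v powr q \<le> t}"
      by (subst nn_integral_cmult_indicator) auto
    finally show "(\<integral>\<^sup>+v. ennreal (exp (- t)) * (if f v powr q \<le> t then 1 else 0) \<partial>lborel) =
        ennreal (exp (- t)) * emeasure lborel {v. f v powr q \<le> t}" .
  qed
  \<comment> \<open>The unsimplified exponent matches Euler's integral for \<open>Gamma\<close> at
    \<open>DIM('a) / q + 1\<close>.\<close>
  also have "\<dots> = (\<integral>\<^sup>+t. ennreal (indicator {0..} t * t powr (DIM('a) / q + 1 - 1) / exp t) * ?V \<partial>lborel)"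
  proof (rule nn_integral_cong_AE)
    \<comment> \<open>Scaling handles \<open>t > 0\<close>, and both sides vanish for
      \<open>t < 0\<close>. At \<open>t = 0\<close> they may differ, because \<open>f\<close> may
      vanish on a set of positive measure.\<close>
    have "AE t in lborel. t \<noteq> (0::real)"
      by (rule AE_lborel_singleton)
    then show "AE t in lborel. ennreal (exp (- t)) * emeasure lborel {v. f v powr q \<le> t} =
        ennreal (indicator {0..} t * t powr (DIM('a) / q + 1 - 1) / exp t) * ?V"
    proof eventually_elim
      case (elim t)
      show ?case
      proof (cases "t > 0")
        case True
        have "f v powr q \<le> t \<longleftrightarrow> f v \<le> t powr (1 / q)" for v
        proof
          assume "f v powr q \<le> t"
          then have "(f v powr q) powr (1 / q) \<le> t powr (1 / q)"
            using q by (intro powr_mono2) auto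
          then show "f v \<le> t powr (1 / q)"
            using q gauge_fn_nonneg[OF f, of v] by (simp add: powr_powr)
        next
          assume "f v \<le> t powr (1 / q)"
          then have "f v powr q \<le> (t powr (1 / q)) powr q"
            using q gauge_fn_nonneg[OF f, of v] by (intro powr_mono2) auto
          then show "f v powr q \<le> t"
            using q True by (simp add: powr_powr)
        qed
        then have "emeasure lborel {v. f v powr q \<le> t} = ennreal ((t powr (1 / q)) ^ DIM('a)) * ?V"
          using emeasure_gauge_le[OF f, of "t powr (1 / q)"] True by simp
        also have "(t powr (1 / q)) ^ DIM('a) = t powr (DIM('a) / q)"
          using True by (simp add: powr_powr flip: powr_realpow)
        finally have "ennreal (exp (- t)) * emeasure lborel {v. f v powr q \<le> t} =
            ennreal (exp (- t)) * ennreal (t powr (DIM('a) / q)) * ?V"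
          by (simp add: mult.assoc)
        also have "ennreal (exp (- t)) * ennreal (t powr (DIM('a) / q)) =
            ennreal (indicator {0..} t * t powr (DIM('a) / q + 1 - 1) / exp t)"
          using True by (simp add: exp_minus divide_inverse mult.commute flip: ennreal_mult)
        finally show ?thesis .
      next
        case False
        with elim have "t < 0" by simp
        moreover from this have "{v. f v powr q \<le> t} = {}"
          using powr_ge_zero[of _ q] by (auto simp: not_le intro: less_le_trans)
        ultimately show ?thesis by simp
      qed
    qed
  qed
  also have "\<dots> = (\<integral>\<^sup>+t. ennreal (indicator {0..} t * t powr (DIM('a) / q + 1 - 1) / exp t) \<partial>lborel) * ?V"
    by (rule nn_integral_multc) measurable
  also have "(\<integral>\<^sup>+t. ennreal (indicator {0..} t * t powr (DIM('a) / q + 1 - 1) / exp t) \<partial>lborel) =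
      ennreal (Gamma (DIM('a) / q + 1))"
    using q by (intro Gamma_conv_nn_integral_real[symmetric]) (simp add: add_nonneg_pos)
  finally show ?thesis .
qed

lemma borel_measurable_vec_nth [measurable]:
  "(\<lambda>v :: 'a::euclidean_space ^ 'k. v $ i) \<in> borel \<rightarrow>\<^sub>M borel"
  by (intro borel_measurable_continuous_onI continuous_intros)

lemma measurable_vec_lambda_PiM [measurable]:
  "(\<lambda>g. \<chi> i. g i) \<in> (\<Pi>\<^sub>M i\<in>(UNIV :: 'k::finite set). (borel :: 'a::euclidean_space measure)) \<rightarrow>\<^sub>M borel"
  by (subst borel_measurable_euclidean_space) (auto simp: Basis_vec_def inner_axis)

text \<open>Lebesgue measure is determined by its values on boxes, and a box in
  \<open>'a ^ 'k\<close> is a product of boxes in \<open>'a\<close>. This transfers Tonelli for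
  \<open>PiM\<close> to vectors.\<close>

lemma lborel_vec_eq_distr_PiM:
  "(lborel :: ('a::euclidean_space ^ 'k) measure) =
     distr (\<Pi>\<^sub>M i\<in>(UNIV :: 'k set). (lborel :: 'a measure)) borel (\<lambda>g. \<chi> i. g i)"
proof (rule lborel_eqI)
  interpret product_sigma_finite "\<lambda>_::'k. lborel :: 'a measure" ..
  fix l u :: "'a ^ 'k"
  assume le: "\<And>b. b \<in> Basis \<Longrightarrow> l \<bullet> b \<le> u \<bullet> b"
  have le': "l $ i \<bullet> b \<le> u $ i \<bullet> b" if "b \<in> Basis" for i b
    using le[of "axis i b"] that by (auto simp: Basis_vec_def inner_axis)
  have pre: "(\<lambda>g. \<chi> i. g i) -` box l u \<inter> space (\<Pi>\<^sub>M i\<in>(UNIV :: 'k set). (lborel :: 'a measure)) =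
      (\<Pi>\<^sub>E i\<in>UNIV. box (l $ i) (u $ i))"
    by (auto simp: mem_box Basis_vec_def inner_axis space_PiM PiE_def Pi_def)
  have "emeasure (distr (\<Pi>\<^sub>M i\<in>(UNIV :: 'k set). (lborel :: 'a measure)) borel (\<lambda>g. \<chi> i. g i)) (box l u) =
      (\<Prod>i\<in>UNIV. emeasure lborel (box (l $ i) (u $ i)))"
    by (subst emeasure_distr) (auto simp: pre emeasure_PiM cong: measurable_cong_sets)
  also have "\<dots> = (\<Prod>i\<in>UNIV. ennreal (\<Prod>b\<in>Basis. (u $ i - l $ i) \<bullet> b))"
    using le' by simp
  also have "\<dots> = ennreal (\<Prod>i\<in>UNIV. \<Prod>b\<in>Basis. (u $ i - l $ i) \<bullet> b)"
    using le' by (intro prod_ennreal prod_nonneg) (auto simp: inner_diff_left)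
  also have "(\<Prod>i\<in>UNIV. \<Prod>b\<in>Basis. (u $ i - l $ i) \<bullet> b) = (\<Prod>b\<in>Basis. (u - l) \<bullet> b)"
  proof -
    \<comment> \<open>The basis of \<open>'a ^ 'k\<close> is the disjoint union of the images of
      \<open>Basis\<close> under \<open>axis i\<close>.\<close>
    have "(\<Prod>b\<in>(\<Union>i\<in>UNIV. axis i ` Basis). (u - l) \<bullet> b) =
        (\<Prod>i\<in>(UNIV :: 'k set). \<Prod>b\<in>axis i ` Basis. (u - l) \<bullet> b)"
      by (rule prod.UNION_disjoint) (auto simp: axis_eq_axis)
    also have "(\<Union>i\<in>UNIV. axis i ` Basis) = (Basis :: ('a ^ 'k) set)"
      by (auto simp: Basis_vec_def)
    also have "(\<Prod>i\<in>(UNIV :: 'k set). \<Prod>b\<in>axis i ` Basis. (u - l) \<bullet> b) =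
        (\<Prod>i\<in>UNIV. \<Prod>b\<in>Basis. (u $ i - l $ i) \<bullet> b)"
      by (intro prod.cong refl, subst prod.reindex)
         (auto simp: inj_on_def axis_eq_axis inner_axis)
    finally show ?thesis by simp
  qed
  finally show "emeasure (distr (\<Pi>\<^sub>M i\<in>(UNIV :: 'k set). (lborel :: 'a measure)) borel (\<lambda>g. \<chi> i. g i)) (box l u) =
      ennreal (\<Prod>b\<in>Basis. (u - l) \<bullet> b)" .
qed simp

lemma nn_integral_lborel_vec_prod:
  fixes g :: "'a::euclidean_space \<Rightarrow> ennreal"
  assumes [measurable]: "g \<in> borel_measurable borel"
  shows "(\<integral>\<^sup>+v. (\<Prod>i\<in>UNIV. g (v $ i)) \<partial>(lborel :: ('a ^ 'k) measure)) =
           (\<integral>\<^sup>+x. g x \<partial>lborel) ^ CARD('k)"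
proof -
  interpret product_sigma_finite "\<lambda>_::'k. lborel :: 'a measure" ..
  have "(\<integral>\<^sup>+v. (\<Prod>i\<in>UNIV. g (v $ i)) \<partial>(lborel :: ('a ^ 'k) measure)) =
      (\<integral>\<^sup>+h. (\<Prod>i\<in>UNIV. g (h i)) \<partial>(\<Pi>\<^sub>M i\<in>(UNIV :: 'k set). (lborel :: 'a measure)))"
    by (subst lborel_vec_eq_distr_PiM, subst nn_integral_distr)
       (auto cong: measurable_cong_sets)
  also have "\<dots> = (\<Prod>i\<in>(UNIV :: 'k set). (\<integral>\<^sup>+x. g x \<partial>lborel))"
    by (rule product_nn_integral_prod) auto
  finally show ?thesis by simp
qed

text \<open>Closure under one level of the mixed norm, so that the ball formula can be
  iterated.\<close>

lemma gauge_fn_lp_norm: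
  fixes f :: "'a::euclidean_space \<Rightarrow> real"
  assumes f: "gauge_fn f" and q: "q > 0"
  shows "gauge_fn (\<lambda>v :: 'a ^ 'k. lp_norm q (\<lambda>i. f (v $ i)))"
  unfolding gauge_fn_def
proof (intro conjI allI impI)
  note [measurable] = gauge_fn_measurable[OF f]
  show "(\<lambda>v :: 'a ^ 'k. lp_norm q (\<lambda>i. f (v $ i))) \<in> borel_measurable borel"
    unfolding lp_norm_def by (cases "q = \<infinity>") simp_all
  show "0 \<le> lp_norm q (\<lambda>i. f (v $ i))" for v :: "'a ^ 'k"
    by (auto simp: lp_norm_def Max_ge_iff)
  fix s :: real and v :: "'a ^ 'k"
  assume s: "s > 0"
  show "lp_norm q (\<lambda>i. f ((s *\<^sub>R v) $ i)) = s * lp_norm q (\<lambda>i. f (v $ i))"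
  proof (cases "q = \<infinity>")
    case True
    \<comment> \<open>Multiplication by \<open>s > 0\<close> is monotone and hence commutes with
      \<open>Max\<close>.\<close>
    have "Max (range (\<lambda>i. s * \<bar>f (v $ i)\<bar>)) = s * Max (range (\<lambda>i. \<bar>f (v $ i)\<bar>))"
      using mono_Max_commute[of "\<lambda>x. s * x" "range (\<lambda>i. \<bar>f (v $ i)\<bar>)"] s
      by (simp add: mono_def image_image)
    with True s show ?thesis
      by (simp add: lp_norm_def gauge_fn_scaleR[OF f] abs_mult)
  next
    case False
    then obtain r where r: "q = ereal r" "r > 0"
      using q by (cases q) auto
    then show ?thesis using s
      by (simp add: lp_norm_def gauge_fn_scaleR[OF f] abs_mult powr_mult powr_powr sum_nonneg
               flip: sum_distrib_left)
  qed
qed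

lemma emeasure_lp_ball_gauge:
  fixes f :: "'a::euclidean_space \<Rightarrow> real"
  assumes f: "gauge_fn f" and q: "q > 0"
    and C: "emeasure lborel {x. f x \<le> 1} = ennreal C" "C \<ge> 0"
  shows "emeasure lborel {v :: 'a ^ 'k. lp_norm q (\<lambda>i. f (v $ i)) \<le> 1} =
           ennreal (C ^ CARD('k) * (Gamma (DIM('a) * real_of_ereal (1 / q) + 1) ^ CARD('k) /
                    Gamma (real CARD('k) * DIM('a) * real_of_ereal (1 / q) + 1)))"
\<comment> \<open>For \<open>q = \<infinity>\<close> the ball is a product of unit balls of
  \<open>f\<close>. Since \<open>1 / q = 0\<close>, all Gamma factors are
  \<open>Gamma 1 = 1\<close>, leaving \<open>C ^ CARD('k)\<close>.\<close>
proof (cases "q = \<infinity>")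
  case True
  note [measurable] = gauge_fn_measurable[OF f]
  let ?B = "{v :: 'a ^ 'k. \<forall>i. f (v $ i) \<le> 1}"
  have B: "{v :: 'a ^ 'k. lp_norm q (\<lambda>i. f (v $ i)) \<le> 1} = ?B"
    using True gauge_fn_nonneg[OF f] by (auto simp: lp_norm_def)
  have "?B \<in> sets borel"
    using gauge_fn_measurable[OF gauge_fn_lp_norm[OF f q]] unfolding B[symmetric] by measurable
  have "emeasure lborel ?B = 
      (\<integral>\<^sup>+v. (\<Prod>i\<in>UNIV. indicator {x. f x \<le> 1} (v $ i)) \<partial>(lborel :: ('a ^ 'k) measure))"
  proof -
    have "(\<Prod>i\<in>UNIV. indicator {x. f x \<le> 1} (v $ i)) = (indicator ?B v :: ennreal)"
      for v :: "'a ^ 'k"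
      by (auto simp: indicator_def of_bool_def )
    with \<open>?B \<in> sets borel\<close> show ?thesis
      by (simp only: nn_integral_indicator sets_lborel)
  qed
  also have "\<dots> = ennreal C ^ CARD('k)"
    by (subst nn_integral_lborel_vec_prod) (auto simp: C)
  finally show ?thesis
    unfolding B using True C by (simp add: ennreal_power)
next
  case False
  then obtain r where r: "q = ereal r" "r > 0"
    using q by (cases q) auto
  note [measurable] = gauge_fn_measurable[OF f]
  let ?N = "\<lambda>v :: 'a ^ 'k. lp_norm q (\<lambda>i. f (v $ i))"
  let ?G = "Gamma (DIM('a) / r + 1)" and ?G' = "Gamma (DIM('a ^ 'k) / r + 1)"
  have pos: "?G > 0" "?G' > 0"
    using r by (intro Gamma_real_pos add_nonneg_pos; simp)+
  \<comment> \<open>The power cancels the outer root, so the exponential splits into one factor per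
    coordinate.\<close>
  have N: "?N v powr r = (\<Sum>i\<in>UNIV. f (v $ i) powr r)" for v
    using r gauge_fn_nonneg[OF f] by (simp add: lp_norm_def powr_powr sum_nonneg)
  have "ennreal ?G' * emeasure lborel {v. ?N v \<le> 1} = (\<integral>\<^sup>+v. ennreal (exp (- (?N v powr r))) \<partial>lborel)"
    using r by (intro nn_integral_exp_gauge[symmetric] gauge_fn_lp_norm f q)
  also have "\<dots> = (\<integral>\<^sup>+v. (\<Prod>i\<in>UNIV. ennreal (exp (- (f (v $ i) powr r)))) \<partial>(lborel :: ('a ^ 'k) measure))"
    by (simp add: N exp_sum prod_ennreal flip: sum_negf)
  also have "\<dots> = (ennreal ?G * ennreal C) ^ CARD('k)"
    using r C by (subst nn_integral_lborel_vec_prod) (auto simp: nn_integral_exp_gauge[OF f])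
  also have "\<dots> = ennreal ((?G * C) ^ CARD('k))"
    using pos C by (simp add: ennreal_power flip: ennreal_mult)
  finally have eq: "ennreal ?G' * emeasure lborel {v. ?N v \<le> 1} = ennreal ((?G * C) ^ CARD('k))" .
  \<comment> \<open>Multiplying by the reciprocal of the positive real \<open>?G'\<close> solves for
    the volume within \<open>ennreal\<close>.\<close>
  have "emeasure lborel {v. ?N v \<le> 1} = ennreal (1 / ?G') * (ennreal ?G' * emeasure lborel {v. ?N v \<le> 1})"
    using pos by (simp flip: mult.assoc ennreal_mult)
  also have "\<dots> = ennreal (1 / ?G' * (?G * C) ^ CARD('k))"
    unfolding eq using pos C by (intro ennreal_mult[symmetric]) auto
  finally show ?thesis
    using r by (simp add: power_mult_distrib mult_ac one_ereal_def)
qed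

text \<open>The ball formula is used first on a row, with \<open>D = DIM('a)\<close> and exponent
  \<open>p\<close>, then on the array of rows, with \<open>D = DIM('a) * CARD('m)\<close> and
  exponent \<open>q\<close>. The row volume enters to the power \<open>CARD('n)\<close>.\<close>

lemma measure_mixed_ball:
  assumes p: "p > 0" and q: "q > 0"
  shows "measure lebesgue (mixed_ball p q :: ('a::euclidean_space ^ 'm ^ 'n) set) =
    unit_ball_vol DIM('a) ^ (CARD('m) * CARD('n)) *
      (Gamma (DIM('a) * real_of_ereal (1 / p) + 1) ^ (CARD('m) * CARD('n)) /
       Gamma (DIM('a) * real CARD('n) * real CARD('m) * real_of_ereal (1 / q) + 1)) *
      (Gamma (DIM('a) * real CARD('m) * real_of_ereal (1 / q) + 1) ^ CARD('n) /
       Gamma (DIM('a) * real CARD('m) * real_of_ereal (1 / p) + 1) ^ CARD('n))"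
proof -
  let ?N = "\<lambda>w :: 'a ^ 'm. lp_norm p (\<lambda>k. norm (w $ k))"
  define C where "C = unit_ball_vol DIM('a) ^ CARD('m) *
      (Gamma (DIM('a) * real_of_ereal (1 / p) + 1) ^ CARD('m) /
       Gamma (real CARD('m) * DIM('a) * real_of_ereal (1 / p) + 1))"
  have nonneg: "0 \<le> real_of_ereal (1 / r)" if "r > 0" for r
    using that by (cases r) (auto simp: one_ereal_def)
  have pos: "Gamma (a * real_of_ereal (1 / r) + 1) > 0" if "r > 0" "a \<ge> 0" for a r
    using that nonneg[of r] by (intro Gamma_real_pos add_nonneg_pos) auto
  have C: "C \<ge> 0"
    unfolding C_def using p
    by (intro mult_nonneg_nonneg zero_le_power divide_nonneg_pos pos less_imp_le[OF pos]) auto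
  have "emeasure lborel {x :: 'a. norm x \<le> 1} = ennreal (unit_ball_vol DIM('a))"
    using emeasure_cball[of 1 "0 :: 'a"] by (simp add: cball_def)
  then have N: "emeasure lborel {w. ?N w \<le> 1} = ennreal C"
    unfolding C_def by (intro emeasure_lp_ball_gauge gauge_fn_norm p) auto
  have gN: "gauge_fn ?N"
    by (intro gauge_fn_lp_norm gauge_fn_norm p)
  have gM: "gauge_fn (\<lambda>z :: 'a ^ 'm ^ 'n. lp_norm q (\<lambda>j. ?N (z $ j)))"
    by (intro gauge_fn_lp_norm gN q)
  \<comment> \<open>Taking \<open>norm\<close> of the entries first changes nothing, as
    \<open>lp_norm\<close> sees only norms; it puts the inner level in the form
    \<open>f (w $ k)\<close>.\<close>
  have ball: "mixed_ball p q = {z :: 'a ^ 'm ^ 'n. lp_norm q (\<lambda>j. ?N (z $ j)) \<le> 1}"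
  proof -
    have "lp_norm p (\<lambda>k. norm (w $ k)) = lp_norm p (\<lambda>k. w $ k)" for w :: "'a ^ 'm"
      by (simp add: lp_norm_def)
    then show ?thesis
      by (simp add: mixed_ball_def mixed_norm_def)
  qed
  have meas: "mixed_ball p q \<in> sets (borel :: ('a ^ 'm ^ 'n) measure)"
    using gauge_fn_measurable[OF gM] unfolding ball by simp
  have "measure lebesgue (mixed_ball p q :: ('a ^ 'm ^ 'n) set) = measure lborel (mixed_ball p q :: ('a ^ 'm ^ 'n) set)"
    using meas by simp
  also have "\<dots> = C ^ CARD('n) * (Gamma (DIM('a ^ 'm) * real_of_ereal (1 / q) + 1) ^ CARD('n) /
      Gamma (real CARD('n) * DIM('a ^ 'm) * real_of_ereal (1 / q) + 1))"
    unfolding measure_def ball emeasure_lp_ball_gauge[OF gN q N C]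
    using C q by (intro enn2real_ennreal mult_nonneg_nonneg zero_le_power divide_nonneg_pos pos less_imp_le[OF pos]) auto
  finally show ?thesis
    by (simp add: C_def power_mult_distrib power_divide mult_ac flip: power_mult)
qed

theorem theorem5:
  fixes p q :: ereal
  assumes "0 < p" and "0 < q"
  shows "measure lebesgue (mixed_ball p q :: (complex ^ 'm ^ 'n) set) =
           (pi / 2) ^ (CARD('m) * CARD('n)) *
             measure lebesgue (mixed_ball (p / 2) (q / 2) :: (real ^ 'm ^ 'n) set) \<and>
         (pi / 2) ^ (CARD('m) * CARD('n)) *
             measure lebesgue (mixed_ball (p / 2) (q / 2) :: (real ^ 'm ^ 'n) set) =
           pi ^ (CARD('m) * CARD('n)) *
             (Gamma (2 * real_of_ereal (1 / p) + 1) ^ (CARD('m) * CARD('n)) /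
              Gamma (2 * real CARD('n) * real CARD('m) * real_of_ereal (1 / q) + 1)) *
             (Gamma (2 * real CARD('m) * real_of_ereal (1 / q) + 1) ^ CARD('n) /
              Gamma (2 * real CARD('m) * real_of_ereal (1 / p) + 1) ^ CARD('n))"
proof -
  \<comment> \<open>For \<open>r = \<infinity>\<close> both reciprocals are 0.\<close>
  have half: "r / 2 > 0 \<and> real_of_ereal (1 / (r / 2)) = 2 * real_of_ereal (1 / r)" if "r > 0" for r :: ereal
    using that by (cases r) (simp_all add: one_ereal_def)
  show ?thesis
    using assms
    \<comment> \<open>The unit ball volumes are \<open>pi\<close> for \<open>complex\<close> and 2
      for \<open>real\<close>, and \<open>half\<close> makes the Gamma arguments agree. Deleting
      \<open>numeral_eq_ereal\<close> keeps \<open>p / 2\<close> in the form that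
      \<open>half\<close> matches.\<close>
    by (simp add: measure_mixed_ball half unit_ball_vol_2 power_divide mult_ac del: numeral_eq_ereal)
qed

end
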